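(* Let $n>0$, $x\ge0$, $\delta\in\mathbb R$ and $y=x^2/(n+x^2)$. Then $$P_n(x;\delta)=\tfrac12\frac{e^{-\frac12\delta^2}}{B(\frac12,\frac12n)}\int_0^y t^{-\frac12}(1-t)^{\frac12n-1}\,{}_1F_1\left(\tfrac12n+\tfrac12;\tfrac12;\tfrac12\delta^2t\right)dt$$ $$\phantom{P_n(x;\delta)}=\tfrac12-\tfrac12\frac{e^{-\frac12\delta^2}}{B(\frac12,\frac12n)}\int_0^{1-y} t^{\frac12n-1}(1-t)^{-\frac12}\,{}_1F_1\left(\tfrac12n+\tfrac12;\tfrac12;\tfrac12\delta^2(1-t)\right)dt,$$ $$Q_n(x;\delta)=\tfrac12\frac{\delta n\,e^{-\frac12\delta^2}}{\sqrt{2\pi}}\int_0^y(1-t)^{\frac12n-1}\,{}_1F_1\left(\tfrac12n+1;\tfrac32;\tfrac12\delta^2t\right)dt$$ $$\phantom{Q_n(x;\delta)}=\tfrac12\operatorname{erf}\left(\delta/\sqrt2\right)-\frac{\delta n\,e^{-\frac12\delta^2}}{2\sqrt{2\pi}}\int_0^{1-y}t^{\frac12n-1}\,{}_1F_1\left(\tfrac12n+1;\tfrac32;\tfrac12\delta^2(1-t)\right)dt.$$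
   Context: Notation. ${}_1F_1(a;b;z)=\sum_{k=0}^\infty\frac{(a)_k}{(b)_k}\frac{z^k}{k!}$ is the Kummer function, with $(a)_k=\Gamma(a+k)/\Gamma(a)$. $\operatorname{erf}(z)=\frac2{\sqrt\pi}\int_0^ze^{-t^2}dt$. $I_y(a,b)=\frac{1}{B(a,b)}\int_0^y t^{a-1}(1-t)^{b-1}dt$ is the normalized incomplete beta function, with $B(a,b)=\Gamma(a)\Gamma(b)/\Gamma(a+b)$. For $x\ge 0$, $\delta\in\mathbb R$, $n>0$ (not necessarily an integer), with $y=x^2/(n+x^2)$, define $$P_n(x;\delta)=\tfrac12 e^{-\frac12\delta^2}\sum_{j=0}^\infty \frac{(\frac12\delta^2)^j}{j!}\, I_y\left(j+\tfrac12,\tfrac12 n\right),\qquad Q_n(x;\delta)=\tfrac12 e^{-\frac12\delta^2}\sum_{j=0}^\infty \frac{\delta}{\sqrt2}\frac{(\frac12\delta^2)^j}{\Gamma(j+\frac32)}\, I_y\left(j+1,\tfrac12 n\right).$$ *)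

theory Defs
  imports "HOL-Analysis.Analysis"
begin

text \<open>
  The integrals are Lebesgue integrals over an oriented interval, so
  \<open>erf\<close> is also correct for negative arguments. The convention
  \<open>0 powr a = 0\<close> only affects the integrands at interval endpoints.
\<close>

definition kummer_1F1 :: "real \<Rightarrow> real \<Rightarrow> real \<Rightarrow> real" where
  "kummer_1F1 a b z = (\<Sum>k. pochhammer a k / pochhammer b k * (z ^ k / fact k))"

definition erf :: "real \<Rightarrow> real" where
  "erf z = 2 / sqrt pi * (LBINT t=ereal 0..ereal z. exp (- t\<^sup>2))"

definition inc_beta :: "real \<Rightarrow> real \<Rightarrow> real \<Rightarrow> real" where
  "inc_beta y a b =
     1 / Beta a b * (LBINT t=ereal 0..ereal y. t powr (a - 1) * (1 - t) powr (b - 1))"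

definition P_nct :: "real \<Rightarrow> real \<Rightarrow> real \<Rightarrow> real" where
  "P_nct n x \<delta> =
     (let y = x\<^sup>2 / (n + x\<^sup>2) in
      1 / 2 * exp (- (1 / 2) * \<delta>\<^sup>2) *
        (\<Sum>j::nat. (1 / 2 * \<delta>\<^sup>2) ^ j / fact j * inc_beta y (real j + 1 / 2) (n / 2)))"

definition Q_nct :: "real \<Rightarrow> real \<Rightarrow> real \<Rightarrow> real" where
  "Q_nct n x \<delta> =
     (let y = x\<^sup>2 / (n + x\<^sup>2) in
      1 / 2 * exp (- (1 / 2) * \<delta>\<^sup>2) *
        (\<Sum>j::nat. \<delta> / sqrt 2 * ((1 / 2 * \<delta>\<^sup>2) ^ j / Gamma (real j + 3 / 2)) *
           inc_beta y (real j + 1) (n / 2)))"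

end

theory Submission imports Defs begin

text \<open>
  Expanding the Kummer function and integrating term by term produces the incomplete beta
  functions, and the coefficients match because
  \<open>(a + b)\<^sub>k B(a + k, b) = (a)\<^sub>k B(a, b)\<close>. At \<open>y = 1\<close> every normalised incomplete
  beta function equals 1, so the full integrals are the series of \<open>exp (\<delta>\<^sup>2 / 2)\<close> and of
  \<open>exp (\<delta>\<^sup>2 / 2) erf (\<delta> / \<surd>2)\<close>; the complementary forms follow by splitting the integral
  at \<open>y\<close> and reflecting \<open>t \<mapsto> 1 - t\<close>.
\<close>

section \<open>Gamma, Beta and Pochhammer identities, and the Beta weight\<close>

lemma Gamma_real_nonzero: "0 < x \<Longrightarrow> Gamma x \<noteq> (0::real)"
  using Gamma_real_pos[of x] by linarith

lemma Beta_real_pos: "0 < a \<Longrightarrow> 0 < b \<Longrightarrow> Beta a b > (0::real)"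
  by (simp add: Beta_def)

lemma pochhammer_Gamma_real:
  fixes a :: real
  assumes "a > 0"
  shows "pochhammer a k = Gamma (a + real k) / Gamma a"
  by (rule pochhammer_Gamma) (use assms in \<open>auto dest: nonpos_Ints_nonpos\<close>)

text \<open>Both sides equal \<open>Gamma (a + k) * Gamma b / Gamma (a + b)\<close>: the factor
  \<open>Gamma (a + b + k)\<close> cancels on the left, \<open>Gamma a\<close> on the right.\<close>

lemma pochhammer_Beta:
  fixes a b :: real
  assumes "a > 0" "b > 0"
  shows "pochhammer (a + b) k * Beta (a + real k) b = pochhammer a k * Beta a b"
proof -
  have "Beta (a + real k) b = Gamma (a + real k) * Gamma b / Gamma (a + b + real k)"
    by (simp add: Beta_def add_ac)
  then show ?thesis
    using assms by (simp add: pochhammer_Gamma_real Beta_def[of a b] Gamma_real_nonzero)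
qed

text \<open>The Beta integral is available as a gauge integral on the closed interval. Nonnegativity
  makes it absolute, and Borel measurability of the weight brings it down from the completed measure
  to \<open>lborel\<close>. The open interval is the one over which interval Lebesgue integrals are
  taken.\<close>

lemma beta_weight_lebesgue:
  fixes a b :: real
  assumes "a > 0" "b > 0"
  shows set_integrable_beta_weight:
      "set_integrable lborel {0<..<1} (\<lambda>t. t powr (a - 1) * (1 - t) powr (b - 1))"
    and LBINT_beta_weight:
      "(LBINT t:{0<..<1}. t powr (a - 1) * (1 - t) powr (b - 1)) = Beta a b"
proof -
  let ?w = "\<lambda>t::real. t powr (a - 1) * (1 - t) powr (b - 1)"
  have hi: "(?w has_integral Beta a b) {0<..<1}"
    using has_integral_Beta_real[OF assms] by (simp add: has_integral_Icc_iff_Ioo)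
  then have "?w absolutely_integrable_on {0<..<1}"
    by (intro nonnegative_absolutely_integrable_1) auto
  then show si: "set_integrable lborel {0<..<1} ?w"
    unfolding set_integrable_def by (subst (asm) integrable_completion) auto
  show "(LBINT t:{0<..<1}. ?w t) = Beta a b"
    using set_borel_integral_eq_integral(2)[OF si] hi by (simp add: integral_unique)
qed

section \<open>Convergence of the Kummer series and termwise integration\<close>

text \<open>Ratio test: consecutive terms have ratio
  \<open>(a + k) / (b + k) * (z / (k + 1))\<close>, whose first factor tends to 1 and second to
  0.\<close>

lemma summable_norm_kummer:
  fixes a b z :: real
  assumes "b > 0"
  shows "summable (\<lambda>k. norm (pochhammer a k / pochhammer b k * (z ^ k / fact k)))"
proof -
  let ?f = "\<lambda>k. norm (pochhammer a k / pochhammer b k * (z ^ k / fact k))"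
  let ?r = "\<lambda>k. (a + real k) / (b + real k) * (z / real (Suc k))"
  have "?r \<longlonglongrightarrow> 1 * 0"
  proof (intro tendsto_mult)
    have "(\<lambda>k. 1 + (a - b) / (b + real k)) \<longlonglongrightarrow> 1 + 0"
      by (intro tendsto_add tendsto_const real_tendsto_divide_at_top[OF tendsto_const]
          filterlim_tendsto_add_at_top[OF tendsto_const] filterlim_real_sequentially)
    moreover have "1 + (a - b) / (b + real k) = (a + real k) / (b + real k)" for k
      using assms by (simp add: field_simps add_pos_nonneg)
    ultimately show "(\<lambda>k. (a + real k) / (b + real k)) \<longlonglongrightarrow> 1" by simp
    show "(\<lambda>k. z / real (Suc k)) \<longlonglongrightarrow> 0"
      by (intro LIMSEQ_Suc[of "\<lambda>k. z / real k"] lim_const_over_n)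
  qed
  then have "(\<lambda>k. norm (?r k)) \<longlonglongrightarrow> 0" by (simp only: mult_zero_right tendsto_norm_zero)
  then have "eventually (\<lambda>k. norm (?r k) < 1 / 2) sequentially"
    by (rule order_tendstoD) simp
  then obtain N where N: "\<And>k. k \<ge> N \<Longrightarrow> norm (?r k) < 1 / 2"
    by (auto simp: eventually_sequentially)
  show ?thesis
  proof (rule summable_ratio_test[of "1/2" N])
    fix k assume "k \<ge> N"
    have "pochhammer a (Suc k) / pochhammer b (Suc k) * (z ^ Suc k / fact (Suc k)) =
        ?r k * (pochhammer a k / pochhammer b k * (z ^ k / fact k))"
      by (simp add: pochhammer_Suc mult_ac)
    then have "norm (?f (Suc k)) = norm (?r k) * norm (?f k)"
      by (simp only: norm_mult real_norm_def abs_mult abs_abs)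
    also have "\<dots> \<le> 1 / 2 * norm (?f k)"
      by (rule mult_right_mono[OF less_imp_le[OF N[OF \<open>k \<ge> N\<close>]]]) simp
    finally show "norm (?f (Suc k)) \<le> 1 / 2 * norm (?f k)" .
  qed simp
qed

text \<open>Since \<open>0 < t < 1\<close> on \<open>S\<close>, the k-th term is dominated by
  \<open>norm (c k) * norm (w t)\<close>. Summability of \<open>c\<close> and integrability of
  \<open>w\<close> therefore justify exchanging sum and integral.\<close>

lemma set_integral_power_series:
  fixes w :: "real \<Rightarrow> real" and c :: "nat \<Rightarrow> real"
  assumes w: "set_integrable lborel {0<..<1} w"
    and c: "summable (\<lambda>k. norm (c k))"
    and S: "S \<in> sets borel" "S \<subseteq> {0<..<1}"
  shows "set_integrable lborel S (\<lambda>t. w t * (\<Sum>k. c k * t ^ k))"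
    and "(\<lambda>k. c k * (LBINT t:S. w t * t ^ k)) sums (LBINT t:S. w t * (\<Sum>k. c k * t ^ k))"
proof -
  \<comment> \<open>The indicator is absorbed into the weight, so the exchange theorems for
    integrals over the whole line apply and every bound holds trivially off
    \<open>S\<close>.\<close>
  let ?g = "\<lambda>t. indicator S t *\<^sub>R w t"
  let ?f = "\<lambda>k t. ?g t * (c k * t ^ k)"
  have g: "integrable lborel ?g"
    using set_integrable_subset[OF w, of S] S by (simp add: set_integrable_def)
  have pow: "norm (t ^ k) \<le> 1" if "t \<in> S" for t :: real and k
    using that S by (auto simp: subset_iff power_abs intro!: power_le_one)
  have bound: "norm (?f k t) \<le> norm (c k) * norm (?g t)" for k t
  proof (cases "t \<in> S")
    case True
    have "norm (c k) * norm (w t) * norm (t ^ k) \<le> norm (c k) * norm (w t) * 1"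
      by (intro mult_left_mono pow True) simp
    then show ?thesis using True by (simp add: abs_mult mult_ac)
  qed simp
  have f: "integrable lborel (?f k)" for k
  proof (rule Bochner_Integration.integrable_bound)
    show "integrable lborel (\<lambda>t. norm (c k) * norm (?g t))"
      by (intro integrable_mult_right integrable_norm g)
    show "?f k \<in> borel_measurable lborel"
      using borel_measurable_integrable[OF g] by measurable
    show "AE t in lborel. norm (?f k t) \<le> norm (norm (c k) * norm (?g t))"
      using bound by (intro AE_I2) (simp only: norm_mult real_norm_def abs_abs abs_mult)
  qed
  have sf: "summable (\<lambda>k. norm (?f k t))" for t
    by (rule summable_comparison_test'[OF summable_mult2[OF c, of "norm (?g t)"]])
       (use bound in simp)
  have si: "summable (\<lambda>k. LBINT t. norm (?f k t))"
  proof (rule summable_comparison_test'[OF summable_mult2[OF c, of "LBINT t. norm (?g t)"]])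
    fix k
    have "(LBINT t. norm (?f k t)) \<le> (LBINT t. norm (c k) * norm (?g t))"
      by (intro integral_mono integrable_norm f integrable_mult_right g bound)
    then show "norm (LBINT t. norm (?f k t)) \<le> norm (c k) * (LBINT t. norm (?g t))"
      by simp
  qed
  have eq: "(\<Sum>k. ?f k t) = indicator S t *\<^sub>R (w t * (\<Sum>k. c k * t ^ k))" for t
  proof (cases "t \<in> S")
    case True
    have "summable (\<lambda>k. c k * t ^ k)"
      by (rule summable_comparison_test'[OF c])
         (use pow[OF True] in \<open>simp add: abs_mult mult_left_le\<close>)
    then show ?thesis using True by (simp add: suminf_mult)
  qed simp
  have ieq: "(LBINT t. ?f k t) = c k * (LBINT t:S. w t * t ^ k)" for k
    unfolding set_lebesgue_integral_def
    by (subst integral_mult_right_zero[symmetric]) (simp add: mult_ac)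
  show "set_integrable lborel S (\<lambda>t. w t * (\<Sum>k. c k * t ^ k))"
    using integrable_suminf[OF f AE_I2[OF sf] si] unfolding eq set_integrable_def .
  show "(\<lambda>k. c k * (LBINT t:S. w t * t ^ k)) sums (LBINT t:S. w t * (\<Sum>k. c k * t ^ k))"
    using sums_integral[OF f AE_I2[OF sf] si] unfolding eq ieq set_lebesgue_integral_def .
qed

text \<open>Multiplying the weight by \<open>t ^ k\<close> turns the exponent \<open>a - 1\<close>
  into \<open>a + k - 1\<close>, so each term integrates to an unnormalised incomplete beta
  function, which is \<open>Beta * inc_beta\<close>. The Kummer parameters \<open>p\<close> and
  \<open>q\<close> stay free so that one statement serves both P and Q.\<close>

lemma kummer_integral:
  fixes a b p q z y :: real
  assumes "a > 0" "b > 0" "q > 0" "0 \<le> y" "y \<le> 1"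
  defines "f \<equiv> (\<lambda>t. t powr (a - 1) * (1 - t) powr (b - 1) * kummer_1F1 p q (z * t))"
  shows "set_integrable lborel {0<..<y} f"
    and "(\<lambda>k. pochhammer p k / pochhammer q k * (z ^ k / fact k) *
             (Beta (a + real k) b * inc_beta y (a + real k) b)) sums (LBINT t=ereal 0..ereal y. f t)"
proof -
  let ?w = "\<lambda>t::real. t powr (a - 1) * (1 - t) powr (b - 1)"
  let ?c = "\<lambda>k. pochhammer p k / pochhammer q k * (z ^ k / fact k)"
  have f: "f = (\<lambda>t. ?w t * (\<Sum>k. ?c k * t ^ k))"
    by (simp add: f_def kummer_1F1_def power_mult_distrib mult_ac)
  note * = set_integral_power_series[OF set_integrable_beta_weight[OF assms(1,2)]
    summable_norm_kummer[OF \<open>q > 0\<close>], of "{0<..<y}" p z]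
  show "set_integrable lborel {0<..<y} f"
    unfolding f by (rule *(1)) (use assms in auto)
  have B: "Beta (a + real k) b * inc_beta y (a + real k) b = (LBINT t:{0<..<y}. ?w t * t ^ k)" for k
  proof -
    have "Beta (a + real k) b \<noteq> 0"
      using Beta_real_pos[of "a + real k" b] assms by simp
    moreover have "(LBINT t:{0<..<y}. t powr (a + real k - 1) * (1 - t) powr (b - 1)) =
        (LBINT t:{0<..<y}. ?w t * t ^ k)"
    proof (rule set_lebesgue_integral_cong)
      \<comment> \<open>The splitting uses \<open>t > 0\<close>, which the open interval
        guarantees.\<close>
      have "t powr (a + real k - 1) = t powr (a - 1) * t ^ k" if "t > 0" for t :: real
        using that by (simp add: powr_realpow[symmetric] powr_add[symmetric] algebra_simps)
      then show "\<forall>t. t \<in> {0<..<y} \<longrightarrow> t powr (a + real k - 1) * (1 - t) powr (b - 1) = ?w t * t ^ k"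
        by simp
    qed simp
    ultimately show ?thesis
      using assms by (simp add: inc_beta_def interval_lebesgue_integral_def)
  qed
  show "(\<lambda>k. ?c k * (Beta (a + real k) b * inc_beta y (a + real k) b)) sums (LBINT t=ereal 0..ereal y. f t)"
    using *(2) assms unfolding B f
    by (simp add: interval_lebesgue_integral_def greaterThanLessThan_subseteq_greaterThanLessThan
        del: times_divide_eq_left times_divide_eq_right)
qed

section \<open>Full integrals and reflection of the upper part\<close>

lemma inc_beta_1:
  assumes "a > 0" "b > 0"
  shows "inc_beta 1 a b = 1"
proof -
  have "Beta a b \<noteq> 0"
    using Beta_real_pos[of a b] assms by simp
  then show ?thesis
    using LBINT_beta_weight[OF assms] by (simp add: inc_beta_def interval_lebesgue_integral_def)
qed

lemma LBINT_unit_reflect: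
  fixes f :: "real \<Rightarrow> real"
  assumes "set_integrable lborel {0<..<1} f" "0 \<le> y" "y \<le> 1"
  shows "(LBINT t=ereal 0..ereal y. f t) =
    (LBINT t=ereal 0..ereal 1. f t) - (LBINT t=ereal 0..ereal (1 - y). f (1 - t))"
proof -
  have "(LBINT t=ereal 0..ereal y. f t) + (LBINT t=ereal y..ereal 1. f t) = (LBINT t=ereal 0..ereal 1. f t)"
    by (rule interval_integral_sum)
       (use assms in \<open>simp add: min_def max_def interval_lebesgue_integrable_def\<close>)
  moreover have "(LBINT t=ereal y..ereal 1. f t) = (LBINT t=ereal 0..ereal (1 - y). f (1 - t))"
  proof -
    have "(LBINT t=ereal y..ereal 1. f t) = (LBINT t. indicator {y<..<1} t *\<^sub>R f t)"
      using assms by (simp add: interval_lebesgue_integral_def set_lebesgue_integral_def)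
    \<comment> \<open>Affine substitution with slope -1 and offset 1; the Jacobian has absolute
      value 1.\<close>
    also have "\<dots> = (LBINT t. indicator {y<..<1} (1 - t) *\<^sub>R f (1 - t))"
      using lborel_integral_real_affine[of "-1" "\<lambda>t. indicator {y<..<1} t *\<^sub>R f t" 1] by simp
    also have "(\<lambda>t. indicator {y<..<1} (1 - t)) = (indicator {0<..<1 - y} :: real \<Rightarrow> real)"
      by (auto simp: indicator_def fun_eq_iff)
    also have "(LBINT t. indicator {0<..<1 - y} t *\<^sub>R f (1 - t)) = (LBINT t=ereal 0..ereal (1 - y). f (1 - t))"
      using assms by (simp add: interval_lebesgue_integral_def set_lebesgue_integral_def)
    finally show ?thesis .
  qed
  ultimately show ?thesis by simp
qed

section \<open>The power series of the error function\<close>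

lemma Gamma_three_halves_real: "Gamma (3 / 2 :: real) = sqrt pi / 2"
  using pochhammer_Gamma_real[of "1 / 2" 1] by (simp add: Gamma_one_half_real)

text \<open>Multiplied by \<open>exp (- u\<^sup>2)\<close>, the series vanishes at 0 and has the
  same derivative as \<open>erf\<close>, hence equals it. This evaluates the Q series at
  \<open>y = 1\<close>.\<close>

lemma erf_power_series:
  "(\<lambda>j. u ^ (2 * j + 1) / Gamma (real j + 3 / 2)) sums (exp (u\<^sup>2) * erf u)"
proof -
  let ?c = "\<lambda>j. 1 / Gamma (real j + 3 / 2)"
  define G where "G v = (\<Sum>j. ?c j * v ^ j)" for v
  have sum: "summable (\<lambda>j. ?c j * v ^ j)" for v
  proof -
    \<comment> \<open>Up to the factor \<open>Gamma (3 / 2)\<close> the series is the Kummer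
      function with parameters 1 and 3/2, because \<open>pochhammer 1 j\<close> cancels
      \<open>fact j\<close>.\<close>
    have "pochhammer 1 j / pochhammer (3 / 2) j * (v ^ j / fact j) = Gamma (3 / 2) * (?c j * v ^ j)" for j
      by (simp add: pochhammer_fact[symmetric] pochhammer_Gamma_real add.commute)
    then have "summable (\<lambda>j. Gamma (3 / 2) * (?c j * v ^ j))"
      using summable_norm_cancel[OF summable_norm_kummer[of "3 / 2" 1 v]] by simp
    then show ?thesis
      by (subst (asm) summable_cmult_iff) (simp add: Gamma_real_nonzero)
  qed
  have dsum: "summable (\<lambda>j. diffs ?c j * v ^ j)" for v
    by (rule termdiff_converges_all[OF sum])
  have dG: "(G has_real_derivative (\<Sum>j. diffs ?c j * v ^ j)) (at v)" for v
    unfolding G_def by (rule termdiffs_strong_converges_everywhere[OF sum])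
  \<comment> \<open>With \<open>v = u\<^sup>2\<close> this says that \<open>exp (- u\<^sup>2) * u * G (u\<^sup>2)\<close> has the derivative of \<open>erf\<close>.\<close>
  have ode: "G v + 2 * v * (\<Sum>j. diffs ?c j * v ^ j) - 2 * v * G v = 2 / sqrt pi" for v
  proof -
    \<comment> \<open>The coefficients come from
      \<open>(2 * j + 1) / Gamma (j + 3 / 2) = 2 / Gamma (j + 1 / 2)\<close>. The series
      \<open>?a\<close> sums to \<open>G v + 2 * v * ?D\<close>; its tail from index 1 is
      \<open>2 * v * G v\<close>, and its term at 0 is
      \<open>2 / Gamma (1 / 2) = 2 / sqrt pi\<close>.\<close>
    let ?a = "\<lambda>j. 2 / Gamma (real j + 1 / 2) * v ^ j"
    let ?D = "\<Sum>j. diffs ?c j * v ^ j"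
    have "(\<lambda>j. ?c j * v ^ j + 2 * v * (real j * ?c j * v ^ (j - Suc 0))) sums (G v + 2 * v * ?D)"
      unfolding G_def by (intro sums_add sums_mult summable_sums[OF sum] diffs_equiv[OF dsum])
    moreover have "?c j * v ^ j + 2 * v * (real j * ?c j * v ^ (j - Suc 0)) = ?a j" for j
    proof -
      have "Gamma (real j + 3 / 2) = (real j + 1 / 2) * Gamma (real j + 1 / 2)"
        using pochhammer_Gamma_real[of "real j + 1 / 2" 1] Gamma_real_nonzero[of "real j + 1 / 2"]
        by (simp add: field_simps)
      then have "(2 * real j + 1) * ?c j = 2 * (real j + 1 / 2) / ((real j + 1 / 2) * Gamma (real j + 1 / 2))"
        by simp
      also have "\<dots> = 2 / Gamma (real j + 1 / 2)"
        by (subst mult_divide_mult_cancel_right[symmetric, of "real j + 1 / 2"]) (simp_all add: mult_ac)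
      finally have "?a j = (2 * real j + 1) * ?c j * v ^ j" by simp
      \<comment> \<open>At \<open>j = 0\<close> the truncated exponent \<open>j - Suc 0\<close> is
        harmless, as its term carries the factor \<open>real j\<close>.\<close>
      then show ?thesis by (cases j) (simp_all add: algebra_simps add_divide_distrib)
    qed
    ultimately have a: "?a sums (G v + 2 * v * ?D)" by simp
    have "(\<lambda>j. 2 * v * (?c j * v ^ j)) sums (2 * v * G v)"
      unfolding G_def by (intro sums_mult summable_sums sum)
    moreover have "2 * v * (?c j * v ^ j) = ?a (Suc j)" for j
      by (simp add: add_ac)
    ultimately have "(\<lambda>j. ?a (Suc j)) sums (2 * v * G v)" by simp
    then have "?a sums (2 * v * G v + 2 / sqrt pi)"
      by (subst (asm) sums_Suc_iff) (simp add: Gamma_one_half_real)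
    with a have "G v + 2 * v * ?D = 2 * v * G v + 2 / sqrt pi" by (rule sums_unique2)
    then show ?thesis by simp
  qed
  define F where "F v = exp (- v\<^sup>2) * (v * G (v\<^sup>2))" for v
  have dF: "(F has_real_derivative 2 / sqrt pi * exp (- v\<^sup>2)) (at v)" for v
  proof -
    let ?D = "\<Sum>j. diffs ?c j * (v\<^sup>2) ^ j"
    have "((\<lambda>v. G (v\<^sup>2)) has_real_derivative ?D * (2 * v)) (at v)"
      by (rule DERIV_chain2[OF dG]) (auto intro!: derivative_eq_intros)
    \<comment> \<open>By the product rule; the bracket is the left side of \<open>ode\<close> at
      \<open>v\<^sup>2\<close>.\<close>
    then have "(F has_real_derivative exp (- v\<^sup>2) * (G (v\<^sup>2) + 2 * v\<^sup>2 * ?D - 2 * v\<^sup>2 * G (v\<^sup>2))) (at v)"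
      unfolding F_def
      by (auto intro!: derivative_eq_intros simp: algebra_simps power2_eq_square)
    then show ?thesis unfolding ode by (simp add: mult_ac)
  qed
  \<comment> \<open>The oriented integral handles negative \<open>u\<close> as well, and
    \<open>F 0 = 0\<close> because of the factor \<open>v\<close>.\<close>
  have "(LBINT t=ereal 0..ereal u. 2 / sqrt pi * exp (- t\<^sup>2)) = F u - F 0"
  proof (rule interval_integral_FTC_finite)
    show "(F has_vector_derivative 2 / sqrt pi * exp (- t\<^sup>2)) (at t within {min 0 u..max 0 u})" for t
      using has_field_derivative_at_within[OF dF]
      unfolding has_real_derivative_iff_has_vector_derivative .
  qed (intro continuous_intros)
  then have "erf u = F u"
    unfolding erf_def by (subst (asm) interval_lebesgue_integral_mult_right) (simp add: F_def)
  then have "u * G (u\<^sup>2) = exp (u\<^sup>2) * erf u"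
    by (simp add: F_def exp_minus)
  moreover have "(\<lambda>j. u * (?c j * (u\<^sup>2) ^ j)) sums (u * G (u\<^sup>2))"
    unfolding G_def by (intro sums_mult summable_sums sum)
  ultimately show ?thesis by (simp add: power_mult)
qed

section \<open>The P and Q series as Kummer integrals\<close>

text \<open>Instance \<open>a = q = 1/2\<close>, \<open>p = b + 1/2\<close> of
  \<open>kummer_integral\<close>: by \<open>pochhammer_Beta\<close> the product
  \<open>(b + 1/2)_k B(1/2 + k, b)\<close> is \<open>(1/2)_k B(1/2, b)\<close>, which cancels the
  denominators. The bound \<open>y\<close> stays general, since the value at 1 is needed
  too.\<close>

lemma P_series:
  fixes b y z :: real
  assumes "b > 0" "0 \<le> y" "y \<le> 1"
  defines "f \<equiv> (\<lambda>t. t powr (- (1 / 2)) * (1 - t) powr (b - 1) * kummer_1F1 (b + 1 / 2) (1 / 2) (z * t))"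
  shows "set_integrable lborel {0<..<y} f"
    and "(\<lambda>j. z ^ j / fact j * inc_beta y (real j + 1 / 2) b)
           sums (1 / Beta (1 / 2) b * (LBINT t=ereal 0..ereal y. f t))"
proof -
  note * = kummer_integral[of "1 / 2" b "1 / 2" y "b + 1 / 2" z]
  show "set_integrable lborel {0<..<y} f"
    using *(1) assms by simp
  have "1 / Beta (1 / 2) b * (pochhammer (b + 1 / 2) k / pochhammer (1 / 2) k * (z ^ k / fact k) *
      (Beta (1 / 2 + real k) b * inc_beta y (1 / 2 + real k) b)) =
      z ^ k / fact k * inc_beta y (real k + 1 / 2) b" (is "?l = _") for k
  proof -
    have pos: "Beta (1 / 2) b > 0" "pochhammer (1 / 2 :: real) k > 0"
      using assms by (auto intro!: Beta_real_pos pochhammer_pos)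
    have "?l = (pochhammer (1 / 2 + b) k * Beta (1 / 2 + real k) b) / (pochhammer (1 / 2) k * Beta (1 / 2) b) *
        (z ^ k / fact k * inc_beta y (real k + 1 / 2) b)"
      by (simp add: add_ac mult_ac)
    also have "\<dots> = z ^ k / fact k * inc_beta y (real k + 1 / 2) b"
      by (subst pochhammer_Beta) (use assms pos in simp_all)
    finally show ?thesis .
  qed
  moreover have "f = (\<lambda>t. t powr (1 / 2 - 1) * (1 - t) powr (b - 1) * kummer_1F1 (b + 1 / 2) (1 / 2) (z * t))"
    by (simp add: f_def)
  ultimately show "(\<lambda>j. z ^ j / fact j * inc_beta y (real j + 1 / 2) b)
      sums (1 / Beta (1 / 2) b * (LBINT t=ereal 0..ereal y. f t))"
    using sums_mult[OF *(2), of "1 / Beta (1 / 2) b"] assms by simp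
qed

text \<open>Instance \<open>a = 1\<close>, \<open>p = b + 1\<close>, \<open>q = 3/2\<close>. Here
  \<open>(1 + b)_k B(1 + k, b) = k! B(1, b) = k! / b\<close>, while \<open>(3/2)_k\<close>
  contributes \<open>Gamma (k + 3 / 2) / (sqrt pi / 2)\<close>; together they produce the constant
  \<open>2 * b / sqrt pi\<close>.\<close>

lemma Q_series:
  fixes b y z :: real
  assumes "b > 0" "0 \<le> y" "y \<le> 1"
  defines "f \<equiv> (\<lambda>t. (1 - t) powr (b - 1) * kummer_1F1 (b + 1) (3 / 2) (z * t))"
  shows "set_integrable lborel {0<..<y} f"
    and "(\<lambda>j. z ^ j / Gamma (real j + 3 / 2) * inc_beta y (real j + 1) b)
           sums (2 * b / sqrt pi * (LBINT t=ereal 0..ereal y. f t))"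
proof -
  \<comment> \<open>The factor \<open>t powr 0\<close> is 1 except at \<open>t = 0\<close>, so
    \<open>?g\<close> and \<open>f\<close> are exchanged by congruence on the open interval.\<close>
  let ?g = "\<lambda>t::real. t powr (1 - 1) * (1 - t) powr (b - 1) * kummer_1F1 (b + 1) (3 / 2) (z * t)"
  note * = kummer_integral[of 1 b "3 / 2" y "b + 1" z]
  have "set_integrable lborel {0<..<y} ?g"
    by (rule *(1)) (use assms in auto)
  also have "?this \<longleftrightarrow> set_integrable lborel {0<..<y} f"
    by (rule set_integrable_cong) (auto simp: f_def)
  finally show "set_integrable lborel {0<..<y} f" .
  have gf: "(LBINT t=ereal 0..ereal y. ?g t) = (LBINT t=ereal 0..ereal y. f t)"
    by (rule interval_integral_cong) (use assms in \<open>auto simp: f_def min_def max_def\<close>)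
  have "2 * b / sqrt pi * (pochhammer (b + 1) k / pochhammer (3 / 2) k * (z ^ k / fact k) *
      (Beta (1 + real k) b * inc_beta y (1 + real k) b)) =
      z ^ k / Gamma (real k + 3 / 2) * inc_beta y (real k + 1) b" (is "?l = _") for k
  proof -
    have "Beta 1 b = 1 / b"
      using pochhammer_Gamma_real[of b 1] assms
      by (simp add: Beta_def Gamma_real_nonzero field_simps)
    then have B: "pochhammer (1 + b) k * Beta (1 + real k) b = fact k / b"
      by (subst pochhammer_Beta) (use assms in \<open>simp_all add: pochhammer_fact[symmetric]\<close>)
    have "pochhammer (3 / 2) k = Gamma (real k + 3 / 2) / (sqrt pi / 2)"
      by (simp add: pochhammer_Gamma_real Gamma_three_halves_real add_ac)
    moreover have "Gamma (real k + 3 / 2) \<noteq> 0" by (intro Gamma_real_nonzero) simp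
    moreover have "?l = 2 * b / sqrt pi * (pochhammer (1 + b) k * Beta (1 + real k) b) / pochhammer (3 / 2) k *
        (z ^ k / fact k * inc_beta y (real k + 1) b)"
      by (simp add: add_ac mult_ac)
    ultimately show ?thesis unfolding B using assms by (simp add: field_simps)
  qed
  then show "(\<lambda>j. z ^ j / Gamma (real j + 3 / 2) * inc_beta y (real j + 1) b)
      sums (2 * b / sqrt pi * (LBINT t=ereal 0..ereal y. f t))"
    using sums_mult[OF *(2), of "2 * b / sqrt pi"] assms(1-3) by (simp only: gf)
qed

section \<open>The four integral representations\<close>

theorem lemma2p1:
  fixes n x \<delta> y :: real
  assumes "n > 0" and "x \<ge> 0" and "y = x\<^sup>2 / (n + x\<^sup>2)"
  shows "(P_nct n x \<delta> =
           1 / 2 * (exp (- (1 / 2) * \<delta>\<^sup>2) / Beta (1 / 2) (n / 2)) *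
             (LBINT t=ereal 0..ereal y. t powr (- (1 / 2)) * (1 - t) powr (n / 2 - 1) *
                kummer_1F1 (n / 2 + 1 / 2) (1 / 2) (1 / 2 * \<delta>\<^sup>2 * t)))
       \<and> (P_nct n x \<delta> =
           1 / 2 - 1 / 2 * (exp (- (1 / 2) * \<delta>\<^sup>2) / Beta (1 / 2) (n / 2)) *
             (LBINT t=ereal 0..ereal (1 - y). t powr (n / 2 - 1) * (1 - t) powr (- (1 / 2)) *
                kummer_1F1 (n / 2 + 1 / 2) (1 / 2) (1 / 2 * \<delta>\<^sup>2 * (1 - t))))
       \<and> (Q_nct n x \<delta> =
           1 / 2 * (\<delta> * n * exp (- (1 / 2) * \<delta>\<^sup>2) / sqrt (2 * pi)) *
             (LBINT t=ereal 0..ereal y. (1 - t) powr (n / 2 - 1) *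
                kummer_1F1 (n / 2 + 1) (3 / 2) (1 / 2 * \<delta>\<^sup>2 * t)))
       \<and> (Q_nct n x \<delta> =
           1 / 2 * erf (\<delta> / sqrt 2) -
           \<delta> * n * exp (- (1 / 2) * \<delta>\<^sup>2) / (2 * sqrt (2 * pi)) *
             (LBINT t=ereal 0..ereal (1 - y). t powr (n / 2 - 1) *
                kummer_1F1 (n / 2 + 1) (3 / 2) (1 / 2 * \<delta>\<^sup>2 * (1 - t))))"
proof -
  define b z where "b = n / 2" and "z = 1 / 2 * \<delta>\<^sup>2"
  have b: "b > 0" and n: "n = 2 * b" using assms by (auto simp: b_def)
  have y: "0 \<le> y" "y \<le> 1"
    using assms by (auto simp: add_pos_nonneg)
  let ?f = "\<lambda>t. t powr (- (1 / 2)) * (1 - t) powr (b - 1) * kummer_1F1 (b + 1 / 2) (1 / 2) (z * t)"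
  let ?g = "\<lambda>t. (1 - t) powr (b - 1) * kummer_1F1 (b + 1) (3 / 2) (z * t)"
  let ?I = "\<lambda>h y. LBINT t=ereal 0..ereal y. h t :: real"
  let ?B = "Beta (1 / 2) b"
  have P: "P_nct n x \<delta> = 1 / 2 * exp (- z) * (1 / ?B * ?I ?f y)"
    using sums_unique[OF P_series(2)[OF b y, of z]]
    by (simp add: P_nct_def Let_def assms(3)[symmetric] b_def z_def)
  have Q: "Q_nct n x \<delta> = 1 / 2 * exp (- z) * (\<delta> / sqrt 2 * (2 * b / sqrt pi * ?I ?g y))"
    using sums_unique[OF sums_mult[OF Q_series(2)[OF b y, of z], of "\<delta> / sqrt 2"]]
    by (simp add: Q_nct_def Let_def assms(3)[symmetric] b_def z_def mult.assoc)
  \<comment> \<open>At \<open>y = 1\<close> all incomplete beta factors are 1, so the full integral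
    is read off from the exponential series.\<close>
  have "(\<lambda>j. z ^ j / fact j) sums (1 / ?B * ?I ?f 1)"
    using P_series(2)[OF b, of 1 z] b by (simp add: inc_beta_1)
  moreover have "(\<lambda>j. z ^ j / fact j) sums exp z"
    using exp_converges[of z] by (simp add: field_simps)
  ultimately have P1: "1 / ?B * ?I ?f 1 = exp z" by (rule sums_unique2)
  \<comment> \<open>Here \<open>z\<close> is the square of \<open>\<delta> / sqrt 2\<close>, which
    matches the odd powers in \<open>erf_power_series\<close>. Keeping the factor
    \<open>\<delta> / sqrt 2\<close> on both sides avoids a separate case \<delta> = 0.\<close>
  have "(\<lambda>j. \<delta> / sqrt 2 * (z ^ j / Gamma (real j + 3 / 2))) sums (\<delta> / sqrt 2 * (2 * b / sqrt pi * ?I ?g 1))"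
    using sums_mult[OF Q_series(2)[OF b, of 1 z], of "\<delta> / sqrt 2"] b by (simp add: inc_beta_1)
  moreover have "(\<lambda>j. \<delta> / sqrt 2 * (z ^ j / Gamma (real j + 3 / 2))) sums (exp z * erf (\<delta> / sqrt 2))"
    using erf_power_series[of "\<delta> / sqrt 2"] by (simp add: power_mult power_divide z_def mult.assoc)
  ultimately have Q1: "\<delta> / sqrt 2 * (2 * b / sqrt pi * ?I ?g 1) = exp z * erf (\<delta> / sqrt 2)"
    by (rule sums_unique2)
  have fy: "?I ?f y = ?I ?f 1 - ?I (\<lambda>t. ?f (1 - t)) (1 - y)"
    by (rule LBINT_unit_reflect[OF P_series(1) y]) (use b in auto)
  have gy: "?I ?g y = ?I ?g 1 - ?I (\<lambda>t. ?g (1 - t)) (1 - y)"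
    by (rule LBINT_unit_reflect[OF Q_series(1) y]) (use b in auto)
  have P2: "P_nct n x \<delta> = 1 / 2 - 1 / 2 * (exp (- z) / ?B) * ?I (\<lambda>t. ?f (1 - t)) (1 - y)"
  proof -
    \<comment> \<open>Linearity isolates the full integral, whose value \<open>exp z\<close> then
      cancels \<open>exp (- z)\<close>.\<close>
    have "P_nct n x \<delta> = 1 / 2 * exp (- z) * (1 / ?B * ?I ?f 1) -
        1 / 2 * (exp (- z) / ?B) * ?I (\<lambda>t. ?f (1 - t)) (1 - y)"
      unfolding P fy by (simp add: right_diff_distrib diff_divide_distrib)
    then show ?thesis unfolding P1 by (simp add: exp_minus)
  qed
  have Q2: "Q_nct n x \<delta> = 1 / 2 * erf (\<delta> / sqrt 2) -
      \<delta> * n * exp (- z) / (2 * sqrt (2 * pi)) * ?I (\<lambda>t. ?g (1 - t)) (1 - y)"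
  proof -
    \<comment> \<open>The constants agree because \<open>n = 2 * b\<close> and
      \<open>sqrt (2 * pi) = sqrt 2 * sqrt pi\<close>.\<close>
    have "Q_nct n x \<delta> = 1 / 2 * exp (- z) * (\<delta> / sqrt 2 * (2 * b / sqrt pi * ?I ?g 1)) -
        \<delta> * n * exp (- z) / (2 * sqrt (2 * pi)) * ?I (\<lambda>t. ?g (1 - t)) (1 - y)"
      unfolding Q gy
      by (simp add: n real_sqrt_mult right_diff_distrib diff_divide_distrib mult_ac)
    then show ?thesis unfolding Q1 by (simp add: exp_minus)
  qed
  show ?thesis
    using P Q P2 Q2 by (simp add: b_def z_def real_sqrt_mult mult_ac)
qed

end
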